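(* For each $n$, let $k(n)$ be a positive integer with $k(n)\le n$, and let $B(n,k(n))$ be the graph of order $n$ which is the disjoint union of $k(n)$ complete balanced bipartite graphs, each of order $\lfloor n/k(n)\rfloor$ or $\lceil n/k(n)\rceil$. If $k(n) = O(n/\log_2 n)$, then \[ \lim_{n\to\infty}\frac{1}{n}\log_2 F(B(n,k(n))) = 1. \]
   Context: A complete balanced bipartite graph of order $m$ is $K_{\lfloor m/2\rfloor,\lceil m/2\rceil}$. For a finite graph $G$, a permutation of the vertices of $G$ is a sequence listing every vertex of $G$ exactly once; two such permutations $\pi,\sigma$ are $G$-different if there is an index $i$ such that $\{\pi(i),\sigma(i)\}$ is an edge of $G$; $F(G)$ denotes the maximum size of a family of pairwise $G$-different permutations of the vertices of $G$. *)

theory Defs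
  imports
    Complex_Main
    "HOL-Library.Landau_Symbols"
    "HOL-Library.Disjoint_Sets"
    "HOL-Combinatorics.Multiset_Permutations"
    "Graph_Theory.Kuratowski"
begin

text \<open>
  A finite simple graph is a \<open>pair_pre_digraph\<close> satisfying \<open>pair_graph\<close>: a finite vertex set
  together with a symmetric irreflexive arc relation, so that \<open>{u, v}\<close> is an edge iff
  \<open>(u, v) \<in> parcs G\<close>. A permutation of the vertices is an element of
  \<open>permutations_of_set (pverts G)\<close>, i.e. a list containing every vertex exactly once.
\<close>

definition graph_different :: "'a pair_pre_digraph \<Rightarrow> 'a list \<Rightarrow> 'a list \<Rightarrow> bool" where
  "graph_different G p q \<longleftrightarrow> (\<exists>i < card (pverts G). (p ! i, q ! i) \<in> parcs G)"

definition max_different_perms :: "'a pair_pre_digraph \<Rightarrow> nat" where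
  "max_different_perms G =
     Max {card S | S. S \<subseteq> permutations_of_set (pverts G) \<and> pairwise (graph_different G) S}"

definition complete_balanced_bipartite :: "'a pair_pre_digraph \<Rightarrow> bool" where
  "complete_balanced_bipartite G \<longleftrightarrow>
     complete_bipartite_digraph
       (nat \<lfloor>real (card (pverts G)) / 2\<rfloor>) (nat \<lceil>real (card (pverts G)) / 2\<rceil>) (with_proj G)"

text \<open>
  \<open>balanced_bipartite_union n k G\<close>: up to isomorphism, \<open>G\<close> is the graph \<open>B(n, k)\<close>. The total order
  \<open>n\<close> determines how many components have each of the two permitted orders.
\<close>

definition balanced_bipartite_union :: "nat \<Rightarrow> nat \<Rightarrow> 'a pair_pre_digraph \<Rightarrow> bool" where
  "balanced_bipartite_union n k G \<longleftrightarrow>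
     pair_graph G \<and> card (pverts G) = n \<and>
     (\<exists>H. (\<forall>i<k. complete_balanced_bipartite (H i) \<and>
                 int (card (pverts (H i))) \<in> {\<lfloor>real n / real k\<rfloor>, \<lceil>real n / real k\<rceil>}) \<and>
          disjoint_family_on (\<lambda>i. pverts (H i)) {..<k} \<and>
          pverts G = (\<Union>i<k. pverts (H i)) \<and>
          parcs G = (\<Union>i<k. parcs (H i)))"

end

theory Submission
  imports Defs "HOL-Real_Asymp.Real_Asymp"
begin

text \<open>
  Fix a proper two-colouring of the graph. Two permutations that differ along an edge have different
  colour patterns, so there are at most \<open>2 ^ n\<close> of them. Conversely, in a complete bipartite graph with
  parts of sizes \<open>m div 2\<close> and \<open>m - m div 2\<close>, permutations with pairwise distinct colour patterns are
  graph-different, which gives \<open>m choose (m div 2) \<ge> 2 ^ m / (m + 1)\<close> of them. Concatenating such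
  families block by block for the \<open>k\<close> components yields at least \<open>2 ^ n / (n / k + 2) ^ k\<close> permutations,
  and \<open>k / n * log 2 (n / k + 2)\<close> vanishes because \<open>k\<close> is \<open>o(n)\<close>.
\<close>

section \<open>Admissible families and their maximum size\<close>

text \<open>Naming the set of admissible families turns \<open>max_different_perms\<close> into the
  \<open>Max\<close> of an image of this set, whose finiteness then gives access to the
  \<open>Max\<close> rules.\<close>

definition different_families :: "'a pair_pre_digraph \<Rightarrow> 'a list set set" where
  "different_families G =
     {S. S \<subseteq> permutations_of_set (pverts G) \<and> pairwise (graph_different G) S}"

lemma length_different_family:
  assumes "S \<in> different_families G" "p \<in> S"
  shows "length p = card (pverts G)"
  using assms by (auto simp: different_families_def length_finite_permutations_of_set)

lemma finite_different_families:
  assumes "finite (pverts G)"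
  shows "finite (different_families G)"
  by (rule finite_subset[of _ "Pow (permutations_of_set (pverts G))"])
     (auto simp: different_families_def)

lemma max_different_perms_eq: "max_different_perms G = Max (card ` different_families G)"
  unfolding max_different_perms_def different_families_def
  by (rule arg_cong[where f = Max]) auto

lemma card_le_max_different_perms:
  assumes "finite (pverts G)" "S \<in> different_families G"
  shows "card S \<le> max_different_perms G"
  unfolding max_different_perms_eq using assms finite_different_families by (intro Max_ge) auto

lemma max_different_perms_le:
  assumes "finite (pverts G)" "\<And>S. S \<in> different_families G \<Longrightarrow> card S \<le> b"
  shows "max_different_perms G \<le> b"
proof -
  \<comment> \<open>The empty family makes the set under \<open>Max\<close> nonempty, which
    \<open>Max_le_iff\<close> requires.\<close>
  have "{} \<in> different_families G" by (simp add: different_families_def)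
  then show ?thesis
    unfolding max_different_perms_eq using assms finite_different_families[OF assms(1)]
    by (subst Max_le_iff) auto
qed

section \<open>Upper bound from a two-colouring\<close>

text \<open>Replacing each vertex by its colour is injective on an admissible family: at an index
  where two members form an edge, their colours differ. The images are Boolean words of length
  \<open>card (pverts G)\<close>.\<close>

lemma max_different_perms_bipartite_le:
  assumes fin: "finite (pverts G)"
    and bip: "\<And>u v. (u, v) \<in> parcs G \<Longrightarrow> (u \<in> U) \<noteq> (v \<in> U)"
  shows "max_different_perms G \<le> 2 ^ card (pverts G)"
proof (rule max_different_perms_le[OF fin])
  fix S assume S: "S \<in> different_families G"
  let ?c = "map (\<lambda>v. v \<in> U)"
  let ?L = "{xs :: bool list. length xs = card (pverts G)}"
  have inj: "inj_on ?c S"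
  proof (rule inj_onI, rule ccontr)
    fix p q assume pq: "p \<in> S" "q \<in> S" "?c p = ?c q" "p \<noteq> q"
    from S pq have "graph_different G p q"
      by (auto simp: different_families_def pairwise_def)
    then obtain i where i: "i < card (pverts G)" "(p ! i, q ! i) \<in> parcs G"
      by (auto simp: graph_different_def)
    from length_different_family[OF S] pq i have "i < length p" "i < length q" by auto
    with pq(3) have "(p ! i \<in> U) = (q ! i \<in> U)" by (metis nth_map)
    with bip[OF i(2)] show False by simp
  qed
  have fin_L: "finite ?L" using finite_lists_length_eq[of "UNIV :: bool set"] by simp
  have "card S = card (?c ` S)" using inj by (simp add: card_image)
  also have "\<dots> \<le> card ?L"
    using length_different_family[OF S] by (intro card_mono fin_L) auto
  also have "\<dots> = 2 ^ card (pverts G)" using card_lists_length_eq[of "UNIV :: bool set"] by simp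
  finally show "card S \<le> 2 ^ card (pverts G)" .
qed

section \<open>Families on disjoint unions\<close>

text \<open>Concatenation is injective on pairs because all first halves have the same length. An
  edge between two first halves stays at its index, and one between two second halves moves by
  \<open>card (pverts G)\<close>.\<close>

lemma different_families_disjoint_union:
  assumes fin: "finite (pverts G)" "finite (pverts H)"
    and disj: "pverts G \<inter> pverts H = {}"
    and S: "S \<in> different_families G" and T: "T \<in> different_families H"
  obtains R where
    "R \<in> different_families \<lparr>pverts = pverts G \<union> pverts H, parcs = parcs G \<union> parcs H\<rparr>"
    "card R = card S * card T"
proof
  let ?K = "\<lparr>pverts = pverts G \<union> pverts H, parcs = parcs G \<union> parcs H\<rparr>"
  let ?f = "\<lambda>(p, q). p @ q"
  note len = length_different_family[OF S] length_different_family[OF T]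
  have card_K: "card (pverts ?K) = card (pverts G) + card (pverts H)"
    using fin disj by (simp add: card_Un_disjoint)
  have "inj_on ?f (S \<times> T)" using len by (auto simp: inj_on_def)
  then show "card (?f ` (S \<times> T)) = card S * card T"
    by (simp add: card_image card_cartesian_product)
  have "?f ` (S \<times> T) \<subseteq> permutations_of_set (pverts ?K)"
    using S T disj by (fastforce simp: different_families_def permutations_of_set_def)
  moreover have "pairwise (graph_different ?K) (?f ` (S \<times> T))"
  proof (rule pairwiseI)
    fix x y assume "x \<in> ?f ` (S \<times> T)" "y \<in> ?f ` (S \<times> T)" "x \<noteq> y"
    then obtain p q p' q' where x: "x = p @ q" "p \<in> S" "q \<in> T"
      and y: "y = p' @ q'" "p' \<in> S" "q' \<in> T" and "p \<noteq> p' \<or> q \<noteq> q'" by auto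
    then consider "p \<noteq> p'" | "q \<noteq> q'" by blast
    then show "graph_different ?K x y"
    proof cases
      case 1
      with S x y have "graph_different G p p'"
        by (auto simp: different_families_def pairwise_def)
      then obtain i where i: "i < card (pverts G)" "(p ! i, p' ! i) \<in> parcs G"
        by (auto simp: graph_different_def)
      with x y len have "(x ! i, y ! i) \<in> parcs ?K" by (simp add: nth_append)
      moreover have "i < card (pverts ?K)" unfolding card_K using i by simp
      ultimately show ?thesis unfolding graph_different_def by blast
    next
      case 2
      with T x y have "graph_different H q q'"
        by (auto simp: different_families_def pairwise_def)
      then obtain i where i: "i < card (pverts H)" "(q ! i, q' ! i) \<in> parcs H"
        by (auto simp: graph_different_def)
      with x y len have "(x ! (card (pverts G) + i), y ! (card (pverts G) + i)) \<in> parcs ?K"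
        by (simp add: nth_append)
      moreover have "card (pverts G) + i < card (pverts ?K)" unfolding card_K using i by simp
      ultimately show ?thesis unfolding graph_different_def by blast
    qed
  qed
  ultimately show "?f ` (S \<times> T) \<in> different_families ?K"
    by (simp add: different_families_def)
qed

lemma different_families_disjoint_UN:
  fixes H :: "nat \<Rightarrow> 'a pair_pre_digraph"
  assumes "\<And>i. i < k \<Longrightarrow> finite (pverts (H i))"
    and "disjoint_family_on (\<lambda>i. pverts (H i)) {..<k}"
    and "\<And>i. i < k \<Longrightarrow> \<exists>S \<in> different_families (H i). card S = N i"
  shows "\<exists>R \<in> different_families \<lparr>pverts = (\<Union>i<k. pverts (H i)), parcs = (\<Union>i<k. parcs (H i))\<rparr>.
    card R = (\<Prod>i<k. N i)"
  using assms
proof (induction k)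
  case 0
  \<comment> \<open>The empty graph has exactly one permutation, the empty list, which matches the
    empty product.\<close>
  have "{[]} \<in> different_families \<lparr>pverts = {}, parcs = {}\<rparr>"
    by (auto simp: different_families_def)
  then show ?case by force
next
  case (Suc k)
  let ?G = "\<lparr>pverts = (\<Union>i<k. pverts (H i)), parcs = (\<Union>i<k. parcs (H i))\<rparr>"
  have "disjoint_family_on (\<lambda>i. pverts (H i)) {..<k}"
    using Suc.prems(2) by (rule disjoint_family_on_mono[rotated]) auto
  with Suc obtain S where S: "S \<in> different_families ?G" "card S = (\<Prod>i<k. N i)" by force
  from Suc.prems(3) obtain T where T: "T \<in> different_families (H k)" "card T = N k" by blast
  have fin: "finite (pverts ?G)" "finite (pverts (H k))" using Suc.prems(1) by auto
  have "pverts (H i) \<inter> pverts (H k) = {}" if "i < k" for i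
    using Suc.prems(2) that by (auto simp: disjoint_family_on_def)
  then have disj: "pverts ?G \<inter> pverts (H k) = {}" by auto
  obtain R where R: "R \<in> different_families
      \<lparr>pverts = pverts ?G \<union> pverts (H k), parcs = parcs ?G \<union> parcs (H k)\<rparr>"
    "card R = card S * card T"
    using different_families_disjoint_union[OF fin disj S(1) T(1)] .
  moreover have "\<lparr>pverts = pverts ?G \<union> pverts (H k), parcs = parcs ?G \<union> parcs (H k)\<rparr> =
      \<lparr>pverts = (\<Union>i<Suc k. pverts (H i)), parcs = (\<Union>i<Suc k. parcs (H i))\<rparr>"
    by (simp add: lessThan_Suc Un_commute)
  ultimately show ?case using S(2) T(2) by auto
qed

section \<open>Lower bound for one complete bipartite graph\<close>

text \<open>Glue a bijection from \<open>A\<close> onto \<open>U\<close> with one from the remaining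
  positions onto \<open>V\<close>, and list the values in order.\<close>

lemma permutation_with_colour_pattern:
  assumes fin: "finite U" "finite V" and disj: "U \<inter> V = {}"
    and A: "A \<subseteq> {..<card U + card V}" "card A = card U"
  obtains p where "p \<in> permutations_of_set (U \<union> V)"
    "\<And>i. i < card U + card V \<Longrightarrow> p ! i \<in> U \<longleftrightarrow> i \<in> A"
proof -
  let ?I = "{..<card U + card V}"
  have finA: "finite A" using A finite_subset by blast
  then have "card (?I - A) = card V" using A by (simp add: card_Diff_subset)
  then obtain f g where f: "bij_betw f A U" and g: "bij_betw g (?I - A) V"
    using finite_same_card_bij finA fin A by (metis finite_Diff finite_lessThan)
  define h where "h i = (if i \<in> A then f i else g i)" for i
  have hA: "bij_betw h A U" using f by (subst bij_betw_cong[of _ _ f]) (auto simp: h_def)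
  have hB: "bij_betw h (?I - A) V" using g by (subst bij_betw_cong[of _ _ g]) (auto simp: h_def)
  have "bij_betw h (A \<union> (?I - A)) (U \<union> V)" using hA hB disj by (rule bij_betw_combine)
  moreover have "A \<union> (?I - A) = ?I" using A by blast
  ultimately have h: "bij_betw h ?I (U \<union> V)" by simp
  show ?thesis
  proof
    show "map h [0..<card U + card V] \<in> permutations_of_set (U \<union> V)"
      using h by (auto simp: permutations_of_set_def distinct_map bij_betw_def atLeast0LessThan)
    fix i assume i: "i < card U + card V"
    show "map h [0..<card U + card V] ! i \<in> U \<longleftrightarrow> i \<in> A"
    proof (cases "i \<in> A")
      case True
      with hA i show ?thesis by (auto simp: bij_betw_def)
    next
      case False
      with hB i have "h i \<in> V" by (auto simp: bij_betw_def)
      with disj False i show ?thesis by auto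
    qed
  qed
qed

text \<open>Choose one permutation for each set of \<open>m\<close> positions, with \<open>U\<close>
  occupying exactly those positions. Where two patterns disagree, one permutation shows a vertex of
  \<open>U\<close> and the other a vertex of \<open>V\<close>, and completeness makes this pair an
  edge.\<close>

lemma complete_bipartite_different_family:
  assumes "complete_bipartite_digraph m n (with_proj G)"
  shows "\<exists>S \<in> different_families G. card S = (m + n) choose m"
proof -
  from assms obtain U V where fin: "finite (pverts G)" and UV: "pverts G = U \<union> V" "U \<inter> V = {}"
    and mn: "card U = m" "card V = n" and E: "parcs G = U \<times> V \<union> V \<times> U"
    unfolding complete_bipartite_digraph_pair_def by blast
  have fin': "finite U" "finite V" using fin UV by auto
  have card_G: "card (pverts G) = m + n" using UV fin' mn by (simp add: card_Un_disjoint)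
  let ?P = "{A. A \<subseteq> {..<m + n} \<and> card A = m}"
  have "\<forall>A \<in> ?P. \<exists>p. p \<in> permutations_of_set (pverts G) \<and> (\<forall>i < m + n. p ! i \<in> U \<longleftrightarrow> i \<in> A)"
  proof
    fix A assume "A \<in> ?P"
    then have A: "A \<subseteq> {..<card U + card V}" "card A = card U" using mn by auto
    show "\<exists>p. p \<in> permutations_of_set (pverts G) \<and> (\<forall>i < m + n. p ! i \<in> U \<longleftrightarrow> i \<in> A)"
      by (rule permutation_with_colour_pattern[OF fin' UV(2) A]) (use UV(1) mn in auto)
  qed
  from bchoice[OF this] obtain p where
    "\<forall>A \<in> ?P. p A \<in> permutations_of_set (pverts G) \<and> (\<forall>i < m + n. p A ! i \<in> U \<longleftrightarrow> i \<in> A)" ..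
  then have p: "\<And>A. A \<in> ?P \<Longrightarrow> p A \<in> permutations_of_set (pverts G)"
    "\<And>A i. A \<in> ?P \<Longrightarrow> i < m + n \<Longrightarrow> p A ! i \<in> U \<longleftrightarrow> i \<in> A"
    by blast+
  have in_V: "p A ! i \<in> V" if "A \<in> ?P" "i < m + n" "i \<notin> A" for A i
  proof -
    have "p A ! i \<in> set (p A)"
      using p(1)[OF that(1)] that card_G by (simp add: length_finite_permutations_of_set)
    then have "p A ! i \<in> U \<union> V" using p(1)[OF that(1)] UV by (simp add: permutations_of_set_def)
    then show ?thesis using p(2)[OF that(1,2)] that by simp
  qed
  have diff: "graph_different G (p A) (p B)" if AB: "A \<in> ?P" "B \<in> ?P" "A \<noteq> B" for A B
  proof -
    have "finite A" "finite B" using AB finite_subset by blast+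
    \<comment> \<open>Equal cardinality enters here: inclusion would force
      \<open>A = B\<close>.\<close>
    then have "\<not> A \<subseteq> B" using AB card_subset_eq[of B A] by auto
    then obtain i where i: "i \<in> A" "i \<notin> B" by blast
    then have "i < m + n" using AB by auto
    with i AB have "p A ! i \<in> U" "p B ! i \<in> V" using p(2) in_V by simp_all
    with E card_G \<open>i < m + n\<close> show ?thesis unfolding graph_different_def by auto
  qed
  have inj: "inj_on p ?P"
  proof (rule inj_onI)
    fix A B assume AB: "A \<in> ?P" "B \<in> ?P" "p A = p B"
    then have "i \<in> A \<longleftrightarrow> i \<in> B" if "i < m + n" for i using p(2) that by metis
    then show "A = B" using AB(1,2) by auto
  qed
  have "p ` ?P \<in> different_families G"
    unfolding different_families_def using p(1) diff by (auto simp: pairwise_def)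
  moreover have "card (p ` ?P) = (m + n) choose m"
    using inj n_subsets[of "{..<m + n}" m] by (simp add: card_image)
  ultimately show ?thesis by blast
qed

text \<open>Writing the larger part as a difference lets the two sizes add up to the order by
  simplification, so the family size becomes a central binomial coefficient.\<close>

lemma complete_balanced_bipartite_parts:
  assumes "complete_balanced_bipartite G"
  shows "complete_bipartite_digraph (card (pverts G) div 2)
    (card (pverts G) - card (pverts G) div 2) (with_proj G)"
proof -
  have "nat \<lfloor>real m / 2\<rfloor> = m div 2" "nat \<lceil>real m / 2\<rceil> = m - m div 2" for m by linarith+
  with assms show ?thesis unfolding complete_balanced_bipartite_def by simp
qed

text \<open>Row \<open>m\<close> of Pascal's triangle has \<open>m + 1\<close> entries, sums to
  \<open>2 ^ m\<close>, and is largest in the middle.\<close>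

lemma two_power_le_central_choose: "2 ^ m \<le> (m + 1) * (m choose (m div 2))"
proof -
  have "(2::nat) ^ m = (\<Sum>i\<le>m. m choose i)" by (simp add: choose_row_sum)
  also have "\<dots> \<le> (\<Sum>i\<le>m. m choose (m div 2))" by (intro sum_mono binomial_maximum)
  finally show ?thesis by simp
qed

section \<open>Both bounds for the union of components\<close>

text \<open>The lower bound multiplies the central binomial coefficients of the components. Each
  falls short of its power of two by a factor of at most \<open>real n / real k + 2\<close>, and
  there are \<open>k\<close> of them.\<close>

lemma max_different_perms_balanced_bipartite_union:
  assumes B: "balanced_bipartite_union n k G" and k: "1 \<le> k"
  shows "max_different_perms G \<le> 2 ^ n"
    and "2 ^ n \<le> real (max_different_perms G) * (real n / real k + 2) ^ k"
proof -
  from B have "pair_graph G" and n: "card (pverts G) = n"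
    by (simp_all add: balanced_bipartite_union_def)
  from B obtain H where
      H_m: "\<forall>i<k. complete_balanced_bipartite (H i) \<and>
        int (card (pverts (H i))) \<in> {\<lfloor>real n / real k\<rfloor>, \<lceil>real n / real k\<rceil>}"
    and disj: "disjoint_family_on (\<lambda>i. pverts (H i)) {..<k}"
    and G: "pverts G = (\<Union>i<k. pverts (H i))" "parcs G = (\<Union>i<k. parcs (H i))"
    unfolding balanced_bipartite_union_def by (elim conjE exE)
  from H_m have H: "\<And>i. i < k \<Longrightarrow> complete_balanced_bipartite (H i)"
    and m: "\<And>i. i < k \<Longrightarrow> int (card (pverts (H i))) \<in> {\<lfloor>real n / real k\<rfloor>, \<lceil>real n / real k\<rceil>}"
    by blast+
  interpret pair_graph G by fact
  let ?m = "\<lambda>i. card (pverts (H i))"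
  note parts = complete_balanced_bipartite_parts[OF H]
  \<comment> \<open>Expressing the second part as a complement leaves a single set per component to
    choose.\<close>
  have "\<exists>U. U \<subseteq> pverts (H i) \<and> parcs (H i) \<subseteq> U \<times> (pverts (H i) - U) \<union> (pverts (H i) - U) \<times> U"
    if i: "i < k" for i
  proof -
    from parts[OF i] obtain U V where UV: "pverts (H i) = U \<union> V" "U \<inter> V = {}"
      and E: "parcs (H i) = U \<times> V \<union> V \<times> U"
      unfolding complete_bipartite_digraph_pair_def by (elim conjE exE)
    have "pverts (H i) - U = V" using UV by blast
    then show ?thesis using UV(1) E by (intro exI[of _ U]) simp
  qed
  then have "\<forall>i \<in> {..<k}. \<exists>U. U \<subseteq> pverts (H i) \<and>
      parcs (H i) \<subseteq> U \<times> (pverts (H i) - U) \<union> (pverts (H i) - U) \<times> U" by blast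
  from bchoice[OF this] obtain U where U: "\<forall>i \<in> {..<k}. U i \<subseteq> pverts (H i) \<and>
      parcs (H i) \<subseteq> U i \<times> (pverts (H i) - U i) \<union> (pverts (H i) - U i) \<times> U i" ..
  \<comment> \<open>Disjointness of the components lets the local colour classes combine: on
    component \<open>i\<close> their union agrees with \<open>U i\<close>.\<close>
  have U_iff: "v \<in> (\<Union>j<k. U j) \<longleftrightarrow> v \<in> U i" if "v \<in> pverts (H i)" "i < k" for v i
  proof
    assume "v \<in> (\<Union>j<k. U j)"
    then obtain j where j: "j < k" "v \<in> U j" by auto
    with U have "v \<in> pverts (H j)" by auto
    with disj that j(1) have "i = j" by (auto simp: disjoint_family_on_def)
    with j show "v \<in> U i" by simp
  qed (use that in auto)
  have colour: "(u \<in> (\<Union>j<k. U j)) \<noteq> (v \<in> (\<Union>j<k. U j))" if uv: "(u, v) \<in> parcs G" for u v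
  proof -
    from uv G obtain i where i: "i < k" "(u, v) \<in> parcs (H i)" by auto
    with U have "u \<in> pverts (H i)" "v \<in> pverts (H i)" "(u \<in> U i) \<noteq> (v \<in> U i)" by fastforce+
    with U_iff i(1) show ?thesis by metis
  qed
  show "max_different_perms G \<le> 2 ^ n"
    using max_different_perms_bipartite_le[of G "\<Union>j<k. U j"] colour n by simp
  have fin: "finite (pverts (H i))" if "i < k" for i
    using parts[OF that] by (simp add: complete_bipartite_digraph_pair_def)
  have fam: "\<exists>S \<in> different_families (H i). card S = ?m i choose (?m i div 2)" if "i < k" for i
    using complete_bipartite_different_family[OF parts[OF that]] by simp
  have "\<lparr>pverts = (\<Union>i<k. pverts (H i)), parcs = (\<Union>i<k. parcs (H i))\<rparr> = G"
    using G by simp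
  with different_families_disjoint_UN[OF fin disj fam]
  obtain R where R: "R \<in> different_families G" "card R = (\<Prod>i<k. ?m i choose (?m i div 2))" by metis
  then have F: "(\<Prod>i<k. ?m i choose (?m i div 2)) \<le> max_different_perms G"
    using card_le_max_different_perms[of G R] by simp
  have "n = (\<Sum>i<k. ?m i)"
    unfolding n[symmetric] G(1) using fin disj
    by (intro card_UN_disjoint) (auto simp: disjoint_family_on_def)
  then have "2 ^ n = (\<Prod>i<k. (2::real) ^ ?m i)" by (simp add: power_sum)
  also have "\<dots> \<le> (\<Prod>i<k. (real n / real k + 2) * real (?m i choose (?m i div 2)))"
  proof (intro prod_mono conjI)
    fix i assume "i \<in> {..<k}"
    then have "int (?m i) \<le> \<lceil>real n / real k\<rceil>"
      using m[of i] floor_le_ceiling[of "real n / real k"] by auto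
    \<comment> \<open>The \<open>2\<close> collects less than 1 from rounding up and 1 from the
      number of entries in the binomial row.\<close>
    then have "real (?m i + 1) \<le> real n / real k + 2" by linarith
    moreover have "(2::real) ^ ?m i \<le> real (?m i + 1) * real (?m i choose (?m i div 2))"
      using two_power_le_central_choose[of "?m i"] by (metis of_nat_le_iff of_nat_mult of_nat_numeral of_nat_power)
    ultimately show "(2::real) ^ ?m i \<le> (real n / real k + 2) * real (?m i choose (?m i div 2))"
      by (meson mult_right_mono of_nat_0_le_iff order_trans)
  qed simp
  also have "\<dots> = (real n / real k + 2) ^ k * real (\<Prod>i<k. ?m i choose (?m i div 2))"
    by (simp add: prod.distrib)
  also have "\<dots> \<le> (real n / real k + 2) ^ k * real (max_different_perms G)"
    using F by (intro mult_left_mono of_nat_mono) auto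
  finally show "2 ^ n \<le> real (max_different_perms G) * (real n / real k + 2) ^ k"
    by (simp add: mult.commute)
qed

section \<open>The limit by squeezing\<close>

theorem theorem4:
  fixes k :: "nat \<Rightarrow> nat" and B :: "nat \<Rightarrow> 'a pair_pre_digraph"
  assumes "\<And>n. n \<ge> 1 \<Longrightarrow> 1 \<le> k n \<and> k n \<le> n"
    and "\<And>n. n \<ge> 1 \<Longrightarrow> balanced_bipartite_union n (k n) (B n)"
    and "(\<lambda>n. real (k n)) \<in> O(\<lambda>n. real n / log 2 (real n))"
  shows "(\<lambda>n. 1 / real n * log 2 (real (max_different_perms (B n)))) \<longlonglongrightarrow> 1"
proof -
  let ?x = "\<lambda>n. real (k n) / real n"
  \<comment> \<open>The growth hypothesis on \<open>k\<close> is used in the form that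
    \<open>k n / n\<close> tends to 0.\<close>
  have "(\<lambda>n. real n / log 2 (real n)) \<in> o(\<lambda>n. real n)" by real_asymp
  with assms(3) have "(\<lambda>n. real (k n)) \<in> o(\<lambda>n. real n)" by (rule landau_o.big_small_trans)
  then have "?x \<longlonglongrightarrow> 0" by (rule smalloD_tendsto)
  \<comment> \<open>Approach to 0 from the right allows composition with the one-sided limit of
    \<open>1 - x * log 2 (1 / x + 2)\<close>. At \<open>n = 0\<close> the quotient is 0 by
    convention, hence \<open>eventually\<close>.\<close>
  moreover have "eventually (\<lambda>n. ?x n > 0) sequentially"
    by (rule eventually_mono[OF eventually_ge_at_top[of 1]]) (use assms(1) in fastforce)
  ultimately have x: "filterlim ?x (at_right 0) sequentially"
    by (rule tendsto_imp_filterlim_at_right)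
  have "((\<lambda>x::real. 1 - x * log 2 (1 / x + 2)) \<longlongrightarrow> 1) (at_right 0)" by real_asymp
  then have lower: "(\<lambda>n. 1 - ?x n * log 2 (1 / ?x n + 2)) \<longlonglongrightarrow> 1"
    using x by (rule filterlim_compose)
  have bounds: "1 - ?x n * log 2 (1 / ?x n + 2) \<le> 1 / real n * log 2 (real (max_different_perms (B n)))
      \<and> 1 / real n * log 2 (real (max_different_perms (B n))) \<le> 1" if n: "n \<ge> 1" for n
  proof -
    let ?F = "real (max_different_perms (B n))" and ?q = "real n / real (k n) + 2"
    have k: "1 \<le> k n" using assms(1)[OF n] by simp
    note F = max_different_perms_balanced_bipartite_union[OF assms(2)[OF n] k]
    have q: "?q > 0" by (simp add: add_nonneg_pos)
    \<comment> \<open>Splitting the logarithm of the product needs positive factors; that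
      \<open>?F\<close> is positive follows from the lower bound itself, as \<open>2 ^ n\<close> is
      positive.\<close>
    have "0 < ?F * ?q ^ k n" using F(2) by (rule less_le_trans[rotated]) simp
    with q have F_pos: "?F > 0" by (simp add: zero_less_mult_iff)
    have "real n = log 2 (2 ^ n)" by simp
    also have "\<dots> \<le> log 2 (?F * ?q ^ k n)" using F(2) by (intro log_mono) auto
    also have "\<dots> = log 2 ?F + real (k n) * log 2 ?q"
      using F_pos q by (simp add: log_mult log_nat_power)
    finally have "real n - real (k n) * log 2 ?q \<le> log 2 ?F" by simp
    \<comment> \<open>Since \<open>1 / ?x n\<close> is \<open>real n / real (k n)\<close>, the
      argument \<open>?q\<close> equals \<open>1 / ?x n + 2\<close>, and division by
      \<open>n\<close> produces the function whose limit is known.\<close>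
    from divide_right_mono[OF this, of "real n"] n
    have "1 - ?x n * log 2 (1 / ?x n + 2) \<le> 1 / real n * log 2 ?F"
      by (simp add: diff_divide_distrib)
    moreover have "?F \<le> 2 ^ n" using F(1) by (metis of_nat_le_iff of_nat_numeral of_nat_power)
    then have "log 2 ?F \<le> log 2 (2 ^ n)" using F_pos by (intro log_mono) auto
    then have "1 / real n * log 2 ?F \<le> 1" using n by simp
    ultimately show ?thesis ..
  qed
  show ?thesis
    by (rule tendsto_sandwich[OF _ _ lower tendsto_const])
       (use bounds in \<open>auto intro!: eventually_sequentiallyI[of 1]\<close>)
qed

end
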